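(* Let $m\in\mathbb{N}$ with $m\ge3$. Then the equation $$v^m-(m^4-1)v^{m+1}-m^4v+1=0$$ has a unique solution $v$ in the interval $[0,1]$. *)

theory Defs
  imports Complex_Main
begin

end

theory Submission
  imports Defs
begin

text \<open>
  The left-hand side is \<open>1\<close> at \<open>v = 0\<close> and \<open>3 - 2 m\<^sup>4 < 0\<close> at \<open>v = 1\<close>, so the intermediate value
  theorem gives a root. The only term that can increase on \<open>[0,1]\<close> is \<open>v\<^sup>m\<close>, whose slope there is
  at most \<open>m\<close>; the term \<open>- m\<^sup>4 v\<close> has slope \<open>- m\<^sup>4 < - m\<close> and outweighs it. The left-hand side is
  therefore strictly decreasing, and the root is unique.
\<close>

theorem theorem4p1:
  fixes m :: nat
  assumes "m \<ge> 3"
  shows "\<exists>!v::real. v \<in> {0..1} \<and>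
    v ^ m - (real m ^ 4 - 1) * v ^ (m + 1) - real m ^ 4 * v + 1 = 0"
proof -
  define f where
    "f v = v ^ m - (real m ^ 4 - 1) * v ^ (m + 1) - real m ^ 4 * v + 1" for v :: real
  have m: "real m > 1" using assms by simp
  have m4: "real m < real m ^ 4"
    using power_strict_increasing[of 1 4 "real m"] m by simp
  have m2: "real m ^ 4 \<ge> 2" using m4 assms by linarith
  have deriv: "(f has_real_derivative
      real m * v ^ (m - 1) - (real m ^ 4 - 1) * (real (m + 1) * v ^ m) - real m ^ 4) (at v)" for v
  proof -
    have pow: "((\<lambda>v. v ^ m) has_real_derivative real m * v ^ (m - 1)) (at v)"
      using DERIV_pow[of m v] by simp
    have pow_Suc: "((\<lambda>v. v ^ (m + 1)) has_real_derivative real (m + 1) * v ^ m) (at v)"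
      using DERIV_pow[of "m + 1" v] by simp
    show ?thesis
      unfolding f_def
      using DERIV_add[OF DERIV_diff[OF DERIV_diff[OF pow DERIV_cmult[OF pow_Suc]]
        DERIV_cmult[OF DERIV_ident]] DERIV_const, of "real m ^ 4 - 1" "real m ^ 4" 1]
      by (simp only: add_0_right mult_1_right)
  qed
  have neg: "real m * v ^ (m - 1) - (real m ^ 4 - 1) * (real (m + 1) * v ^ m) - real m ^ 4 < 0"
    if "0 \<le> v" "v \<le> 1" for v :: real
  proof -
    have "real m * v ^ (m - 1) \<le> real m"
      using that by (simp add: mult_left_le power_le_one)
    moreover have "(real m ^ 4 - 1) * (real (m + 1) * v ^ m) \<ge> 0"
      using that m2 by (intro mult_nonneg_nonneg) auto
    ultimately show ?thesis using m4 by linarith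
  qed
  have decr: "f w < f v" if "0 \<le> v" "v < w" "w \<le> 1" for v w
  proof (rule DERIV_neg_imp_decreasing[OF that(2)])
    fix x assume "v \<le> x" "x \<le> w"
    then have "0 \<le> x" "x \<le> 1" using that by auto
    then show "\<exists>y. (f has_real_derivative y) (at x) \<and> y < 0"
      using deriv[of x] neg[of x] by (intro exI conjI)
  qed
  have "\<exists>v\<ge>0. v \<le> 1 \<and> f v = 0"
  proof (rule IVT2)
    show "f 1 \<le> 0" using m2 by (simp add: f_def)
    show "0 \<le> f 0" using assms by (simp add: f_def)
    show "\<forall>x. 0 \<le> x \<and> x \<le> 1 \<longrightarrow> isCont f x" by (intro allI impI DERIV_isCont[OF deriv])
  qed simp
  then obtain v where v: "0 \<le> v" "v \<le> 1" "f v = 0" by blast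
  have unique: "w = v" if "0 \<le> w" "w \<le> 1" "f w = 0" for w
    using decr[of v w] decr[of w v] v that by (cases w v rule: linorder_cases) auto
  have "\<exists>!v. v \<in> {0..1} \<and> f v = 0"
  proof (rule ex1I)
    show "v \<in> {0..1} \<and> f v = 0" using v by simp
    show "w = v" if "w \<in> {0..1} \<and> f w = 0" for w using that unique[of w] by simp
  qed
  then show ?thesis unfolding f_def .
qed

end
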